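(* Let $g\in\mathbb{C}^N$ and let $\alpha,\beta>0$. Then the family $\{T_i M_s g : 1\le i,s\le N\}$ is a frame for $\mathbb{C}^N$ with frame bounds $\alpha$ and $\beta$ if and only if $$\frac{\alpha}{N}\le\sum_{n=1}^N|\chi_l(n)|^2|g(n)|^2\le\frac{\beta}{N}\quad\text{for all } l\in\{1,\dots,N\}.$$
   Context: Let $G$ be an undirected, connected, weighted graph with vertex set $\mathcal V=\{1,\dots,N\}$, and let $A$ be an $N\times N$ diagonalizable matrix associated with $G$ (for example its adjacency matrix or its graph Laplacian), with eigenvalues $\lambda_1,\dots,\lambda_N$ (listed with multiplicity) and corresponding eigenvectors $\chi_1,\dots,\chi_N$ forming an orthonormal basis of $\mathbb{C}^N$. A signal $f:\mathcal V\to\mathbb{C}$ is identified with the vector $(f(1),\dots,f(N))\in\mathbb{C}^N$. The graph Fourier transform of $f\in\mathbb{C}^N$ is $\widehat f(\lambda_l)=\sum_{n=1}^N f(n)\overline{\chi_l(n)}$, $l=1,\dots,N$ (indexed by $l$). The generalized convolution is $(f\ast g)(n)=\sum_{l=1}^N \widehat f(\lambda_l)\widehat g(\lambda_l)\chi_l(n)$. For $i=1,\dots,N$, $\delta_i\in\mathbb{C}^N$ is given by $\delta_i(n)=1$ if $n=i$ and $0$ otherwise, and the generalized translation is $T_i f=\sqrt N\,(f\ast\delta_i)$. The generalized modulation $M_s$, $1\le s\le N$, is $(M_s f)(n)=\chi_s(n)f(n)$, $n=1,\dots,N$. A (finite, indexed) family $\{f_k\}$ in $\mathbb{C}^N$ is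 a frame for $\mathbb{C}^N$ with frame bounds $\alpha,\beta>0$ if $\alpha\|f\|^2\le\sum_k|\langle f,f_k\rangle|^2\le\beta\|f\|^2$ for all $f\in\mathbb{C}^N$. *)

theory Defs
  imports "HOL-Analysis.Analysis"
begin

text \<open>
  The vertex set is a finite type \<open>'n\<close> with \<open>N = CARD('n)\<close>; the same type indexes the
  eigenvalues and eigenvectors, since there are also \<open>N\<close> of these. No ordering of the indices
  is ever used.
\<close>

text \<open>
  A weighted graph is given by its weight function, the edges being the pairs of nonzero weight.
  Neither positivity of the weights nor absence of loops is imposed.
\<close>

definition weighted_edges :: "('n \<Rightarrow> 'n \<Rightarrow> real) \<Rightarrow> ('n \<times> 'n) set" where
  "weighted_edges w = {(i, j). w i j \<noteq> 0}"

definition undirected_graph :: "('n \<Rightarrow> 'n \<Rightarrow> real) \<Rightarrow> bool" where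
  "undirected_graph w \<longleftrightarrow> (\<forall>i j. w i j = w j i)"

definition connected_graph :: "('n \<Rightarrow> 'n \<Rightarrow> real) \<Rightarrow> bool" where
  "connected_graph w \<longleftrightarrow> (\<forall>i j. (i, j) \<in> (weighted_edges w)\<^sup>*)"

text \<open>
  The class instance \<open>inner\<close> on \<open>complex ^ 'n\<close> is real-valued (the real part of the Hermitian
  product below). The norms induced by the two products agree.
\<close>

definition cinner :: "complex ^ 'n \<Rightarrow> complex ^ 'n \<Rightarrow> complex" where
  "cinner f h = (\<Sum>n\<in>UNIV. f $ n * cnj (h $ n))"

definition orthonormal_basis :: "('n \<Rightarrow> complex ^ 'n) \<Rightarrow> bool" where
  "orthonormal_basis u \<longleftrightarrow>
     (\<forall>k l. cinner (u k) (u l) = (if k = l then 1 else 0)) \<and> vec.span (range u) = UNIV"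

text \<open>
  Existence of such a basis entails that \<open>A\<close> is diagonalizable and that \<open>\<mu>\<close> lists
  its eigenvalues with multiplicity.
\<close>

definition orthonormal_eigenbasis ::
    "complex ^ 'n ^ 'n \<Rightarrow> ('n \<Rightarrow> complex) \<Rightarrow> ('n \<Rightarrow> complex ^ 'n) \<Rightarrow> bool" where
  "orthonormal_eigenbasis A \<mu> u \<longleftrightarrow>
     orthonormal_basis u \<and> (\<forall>l. A *v u l = \<mu> l *s u l)"

text \<open>
  The transform is a function of the index \<open>l\<close>, not of the eigenvalue \<open>\<mu> l\<close>:
  for repeated eigenvalues the value at \<open>\<mu> l\<close> alone would be ambiguous.
\<close>

definition graph_fourier :: "('n \<Rightarrow> complex ^ 'n) \<Rightarrow> complex ^ 'n \<Rightarrow> 'n \<Rightarrow> complex" where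
  "graph_fourier u f l = (\<Sum>n\<in>UNIV. f $ n * cnj (u l $ n))"

definition graph_convolution ::
    "('n \<Rightarrow> complex ^ 'n) \<Rightarrow> complex ^ 'n \<Rightarrow> complex ^ 'n \<Rightarrow> complex ^ 'n" where
  "graph_convolution u f g =
     (\<chi> n. \<Sum>l\<in>UNIV. graph_fourier u f l * graph_fourier u g l * u l $ n)"

definition delta :: "'n \<Rightarrow> complex ^ 'n" where
  "delta i = (\<chi> n. if n = i then 1 else 0)"

definition graph_translation ::
    "('n \<Rightarrow> complex ^ 'n) \<Rightarrow> 'n \<Rightarrow> complex ^ 'n \<Rightarrow> complex ^ 'n" where
  "graph_translation u i f =
     complex_of_real (sqrt (real CARD('n))) *s graph_convolution u f (delta i)"

definition graph_modulation ::
    "('n \<Rightarrow> complex ^ 'n) \<Rightarrow> 'n \<Rightarrow> complex ^ 'n \<Rightarrow> complex ^ 'n" where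
  "graph_modulation u s f = (\<chi> n. u s $ n * f $ n)"

definition is_frame_with_bounds ::
    "'k set \<Rightarrow> ('k \<Rightarrow> complex ^ 'n) \<Rightarrow> real \<Rightarrow> real \<Rightarrow> bool" where
  "is_frame_with_bounds K F \<alpha> \<beta> \<longleftrightarrow>
     finite K \<and> 0 < \<alpha> \<and> 0 < \<beta> \<and>
     (\<forall>f. \<alpha> * (norm f)\<^sup>2 \<le> (\<Sum>k\<in>K. (cmod (cinner f (F k)))\<^sup>2) \<and>
          (\<Sum>k\<in>K. (cmod (cinner f (F k)))\<^sup>2) \<le> \<beta> * (norm f)\<^sup>2)"

end

theory Submission imports Defs begin

text \<open>
  Since \<open>\<langle>f, T\<^sub>i h\<rangle>\<close> is \<open>sqrt N\<close> times the value at vertex \<open>i\<close> of the signal with Fourier coefficients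
  \<open>f^(l) * cnj (h^(l))\<close>, Parseval turns the sum over \<open>i\<close> into \<open>N * (\<Sum>l. |f^(l)|\<^sup>2 * |h^(l)|\<^sup>2)\<close>.
  For \<open>h = M\<^sub>s g\<close> the matrix \<open>u\<close> is square and therefore has orthonormal columns as well as rows, so
  the sum of \<open>|h^(l)|\<^sup>2\<close> over \<open>s\<close> equals \<open>\<Sum>n. |u l n|\<^sup>2 * |g n|\<^sup>2\<close>. The frame
  operator is thus diagonal in the basis \<open>u\<close>, and its diagonal entries are the optimal bounds.
\<close>

text \<open>Expanding the squared modulus gives a double sum over pairs of coefficients, of which
  orthonormality keeps the diagonal. The family \<open>v\<close> and its coordinates are kept
  general so that the rows of the basis matrix, its columns and their conjugates can all be plugged
  in.\<close>

lemma sum_cmod_orthonormal_combination: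
  fixes v :: "'k::finite \<Rightarrow> 'i::finite \<Rightarrow> complex"
  assumes "\<And>k l. (\<Sum>i\<in>UNIV. v k i * cnj (v l i)) = (if k = l then 1 else 0)"
  shows "(\<Sum>i\<in>UNIV. (cmod (\<Sum>l\<in>UNIV. a l * v l i))\<^sup>2) = (\<Sum>l\<in>UNIV. (cmod (a l))\<^sup>2)"
proof -
  have "complex_of_real (\<Sum>i\<in>UNIV. (cmod (\<Sum>l\<in>UNIV. a l * v l i))\<^sup>2)
      = (\<Sum>i\<in>UNIV. \<Sum>k\<in>UNIV. \<Sum>l\<in>UNIV. a k * v k i * (cnj (a l) * cnj (v l i)))"
    by (simp only: of_real_sum complex_norm_square cnj_sum complex_cnj_mult sum_product)
  also have "\<dots> = (\<Sum>k\<in>UNIV. \<Sum>i\<in>UNIV. \<Sum>l\<in>UNIV. a k * v k i * (cnj (a l) * cnj (v l i)))"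
    by (rule sum.swap)
  also have "\<dots> = (\<Sum>k\<in>UNIV. \<Sum>l\<in>UNIV. \<Sum>i\<in>UNIV. a k * v k i * (cnj (a l) * cnj (v l i)))"
    by (intro sum.cong refl sum.swap)
  also have "\<dots> = (\<Sum>k\<in>UNIV. \<Sum>l\<in>UNIV. a k * cnj (a l) * (\<Sum>i\<in>UNIV. v k i * cnj (v l i)))"
    by (simp add: sum_distrib_left mult_ac)
  also have "\<dots> = (\<Sum>k\<in>UNIV. a k * cnj (a k))"
    by (simp add: assms if_distrib cong: if_cong)
  also have "\<dots> = complex_of_real (\<Sum>l\<in>UNIV. (cmod (a l))\<^sup>2)"
    by (simp only: of_real_sum complex_norm_square)
  finally show ?thesis
    by (simp only: of_real_eq_iff)
qed

text \<open>Orthonormal rows say that the conjugate transpose is a right inverse; for a square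
  matrix it is then also a left inverse.\<close>

lemma orthonormal_columns_if_rows:
  fixes v :: "'n::finite \<Rightarrow> 'n \<Rightarrow> complex"
  assumes "\<And>k l. (\<Sum>i\<in>UNIV. v k i * cnj (v l i)) = (if k = l then 1 else 0)"
  shows "(\<Sum>l\<in>UNIV. v l i * cnj (v l j)) = (if i = j then 1 else 0)"
proof -
  define V :: "complex ^ 'n ^ 'n" where "V = (\<chi> l i. v l i)"
  define W :: "complex ^ 'n ^ 'n" where "W = (\<chi> i l. cnj (v l i))"
  have "V ** W = mat 1"
    by (simp add: vec_eq_iff V_def W_def matrix_matrix_mult_def mat_def assms)
  then have "W ** V = mat 1"
    using matrix_left_right_inverse by blast
  \<comment> \<open>The indices are reversed because \<open>W\<close> carries the conjugate, which
    belongs to \<open>j\<close>.\<close>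
  then have "(W ** V) $ j $ i = (mat 1 :: complex ^ 'n ^ 'n) $ j $ i"
    by simp
  then show ?thesis
    by (auto simp: V_def W_def matrix_matrix_mult_def mat_def mult.commute)
qed

context
  fixes u :: "'n::finite \<Rightarrow> complex ^ 'n"
  assumes orthonormal: "orthonormal_basis u"
begin

lemma orthonormal_rows:
  "(\<Sum>i\<in>UNIV. u k $ i * cnj (u l $ i)) = (if k = l then 1 else 0)"
  using orthonormal by (simp add: orthonormal_basis_def cinner_def)

lemma orthonormal_columns:
  "(\<Sum>l\<in>UNIV. u l $ i * cnj (u l $ j)) = (if i = j then 1 else 0)"
  by (rule orthonormal_columns_if_rows) (rule orthonormal_rows)

text \<open>The transform combines the conjugated columns of the basis matrix with coefficients
  \<open>f $ n\<close>, so column orthonormality applies.\<close>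

lemma graph_fourier_parseval:
  "(\<Sum>l\<in>UNIV. (cmod (graph_fourier u f l))\<^sup>2) = (norm f)\<^sup>2"
proof -
  have "(\<Sum>l\<in>UNIV. (cmod (graph_fourier u f l))\<^sup>2) = (\<Sum>n\<in>UNIV. (cmod (f $ n))\<^sup>2)"
    unfolding graph_fourier_def
    by (rule sum_cmod_orthonormal_combination)
      (simp add: mult.commute[of "cnj _"] orthonormal_columns eq_commute)
  then show ?thesis
    by (simp add: norm_vec_def L2_set_def sum_nonneg)
qed

lemma graph_fourier_basis: "graph_fourier u (u k) l = (if k = l then 1 else 0)"
  by (simp add: graph_fourier_def orthonormal_rows)

lemma graph_fourier_delta: "graph_fourier u (delta i) l = cnj (u l $ i)"
  by (simp add: graph_fourier_def delta_def if_distrib[of "\<lambda>x. x * _"] cong: if_cong)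

text \<open>Conjugation in the second argument of \<open>cinner\<close> turns the coefficient
  \<open>cnj (u l $ i)\<close> of \<open>delta i\<close> into \<open>u l $ i\<close>, and the sum
  over \<open>n\<close> reassembles the transform of \<open>f\<close>. As a function of
  \<open>i\<close> this is a combination of rows.\<close>

lemma cinner_graph_translation:
  "cinner f (graph_translation u i h) = complex_of_real (sqrt (real CARD('n)))
     * (\<Sum>l\<in>UNIV. graph_fourier u f l * cnj (graph_fourier u h l) * u l $ i)"
proof -
  have "cinner f (graph_translation u i h) = (\<Sum>n\<in>UNIV. \<Sum>l\<in>UNIV.
      complex_of_real (sqrt (real CARD('n)))
        * (f $ n * cnj (u l $ n) * cnj (graph_fourier u h l) * u l $ i))"
    by (simp add: cinner_def graph_translation_def graph_convolution_def graph_fourier_delta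
        sum_distrib_left mult_ac)
  also have "\<dots> = (\<Sum>l\<in>UNIV. \<Sum>n\<in>UNIV. complex_of_real (sqrt (real CARD('n)))
        * (f $ n * cnj (u l $ n) * cnj (graph_fourier u h l) * u l $ i))"
    by (rule sum.swap)
  finally show ?thesis
    unfolding graph_fourier_def[of u f]
    by (simp only: sum_distrib_left sum_distrib_right)
qed

lemma sum_cinner_graph_translation:
  "(\<Sum>i\<in>UNIV. (cmod (cinner f (graph_translation u i h)))\<^sup>2) =
     real CARD('n) * (\<Sum>l\<in>UNIV. (cmod (graph_fourier u f l))\<^sup>2 * (cmod (graph_fourier u h l))\<^sup>2)"
  unfolding cinner_graph_translation norm_mult power_mult_distrib
  by (simp add: sum_distrib_left[symmetric] norm_mult power_mult_distrib
      sum_cmod_orthonormal_combination[of "\<lambda>l i. u l $ i", OF orthonormal_rows])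

text \<open>For fixed \<open>l\<close>, the transform as a function of \<open>s\<close> is a
  combination of columns with coefficients \<open>g $ n * cnj (u l $ n)\<close>.\<close>

lemma sum_graph_fourier_modulation:
  "(\<Sum>s\<in>UNIV. (cmod (graph_fourier u (graph_modulation u s g) l))\<^sup>2) =
     (\<Sum>n\<in>UNIV. (cmod (u l $ n))\<^sup>2 * (cmod (g $ n))\<^sup>2)"
proof -
  have "graph_fourier u (graph_modulation u s g) l
      = (\<Sum>n\<in>UNIV. g $ n * cnj (u l $ n) * u s $ n)" for s
    by (simp add: graph_fourier_def graph_modulation_def mult_ac)
  then show ?thesis
    by (simp only: sum_cmod_orthonormal_combination[of "\<lambda>n s. u s $ n", OF orthonormal_columns])
      (simp add: norm_mult power_mult_distrib mult.commute)
qed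

lemma sum_cinner_translation_modulation:
  "(\<Sum>(i, s)\<in>UNIV. (cmod (cinner f (graph_translation u i (graph_modulation u s g))))\<^sup>2) =
     (\<Sum>l\<in>UNIV. (cmod (graph_fourier u f l))\<^sup>2 *
       (real CARD('n) * (\<Sum>n\<in>UNIV. (cmod (u l $ n))\<^sup>2 * (cmod (g $ n))\<^sup>2)))"
proof -
  let ?F = "\<lambda>l. (cmod (graph_fourier u f l))\<^sup>2"
  let ?G = "\<lambda>s l. (cmod (graph_fourier u (graph_modulation u s g) l))\<^sup>2"
  have "(\<Sum>(i, s)\<in>UNIV. (cmod (cinner f (graph_translation u i (graph_modulation u s g))))\<^sup>2) =
      (\<Sum>i\<in>UNIV. \<Sum>s\<in>UNIV. (cmod (cinner f (graph_translation u i (graph_modulation u s g))))\<^sup>2)"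
    by (simp add: sum.cartesian_product)
  \<comment> \<open>With \<open>s\<close> outermost, the inner sum over \<open>i\<close> concerns
    the translates of one fixed signal.\<close>
  also have "\<dots> = (\<Sum>s\<in>UNIV. real CARD('n) * (\<Sum>l\<in>UNIV. ?F l * ?G s l))"
    by (subst sum.swap) (simp only: sum_cinner_graph_translation)
  also have "\<dots> = (\<Sum>l\<in>UNIV. \<Sum>s\<in>UNIV. real CARD('n) * (?F l * ?G s l))"
    by (subst sum.swap) (simp only: sum_distrib_left)
  also have "\<dots> = (\<Sum>l\<in>UNIV. ?F l * (real CARD('n) * (\<Sum>s\<in>UNIV. ?G s l)))"
    by (simp add: sum_distrib_left mult_ac)
  finally show ?thesis
    by (simp only: sum_graph_fourier_modulation)
qed

text \<open>Testing on \<open>u k\<close>, a unit vector whose transform is concentrated at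
  \<open>k\<close>, isolates \<open>c k\<close>. Conversely, Parseval turns
  \<open>(norm f)\<^sup>2\<close> into a sum that can be compared term by term.\<close>

lemma diagonal_bounds_iff:
  fixes c :: "'n \<Rightarrow> real"
  shows "(\<forall>f. \<alpha> * (norm f)\<^sup>2 \<le> (\<Sum>l\<in>UNIV. (cmod (graph_fourier u f l))\<^sup>2 * c l) \<and>
          (\<Sum>l\<in>UNIV. (cmod (graph_fourier u f l))\<^sup>2 * c l) \<le> \<beta> * (norm f)\<^sup>2)
    \<longleftrightarrow> (\<forall>l. \<alpha> \<le> c l \<and> c l \<le> \<beta>)" (is "?L \<longleftrightarrow> ?R")
proof
  assume L: ?L
  show ?R
  proof
    fix k
    have "(cmod (graph_fourier u (u k) l))\<^sup>2 = (if k = l then 1 else 0)" for l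
      by (simp add: graph_fourier_basis)
    then have "(\<Sum>l\<in>UNIV. (cmod (graph_fourier u (u k) l))\<^sup>2 * c l) = c k" "(norm (u k))\<^sup>2 = 1"
      by (simp_all add: if_distrib[of "\<lambda>x. x * _"] graph_fourier_parseval[symmetric] cong: if_cong)
    then show "\<alpha> \<le> c k \<and> c k \<le> \<beta>"
      using L[rule_format, of "u k"] by simp
  qed
next
  assume ?R
  then show ?L
    by (auto simp: graph_fourier_parseval[symmetric] sum_distrib_left mult.commute[of \<alpha>]
        mult.commute[of \<beta>] intro!: sum_mono mult_left_mono)
qed

end

theorem corollary5p5:
  fixes w :: "'n::finite \<Rightarrow> 'n \<Rightarrow> real"
    and A :: "complex ^ 'n ^ 'n"
    and \<mu> :: "'n \<Rightarrow> complex"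
    and u :: "'n \<Rightarrow> complex ^ 'n"
    and g :: "complex ^ 'n"
    and \<alpha> \<beta> :: real
  assumes "undirected_graph w" and "connected_graph w"
    and "orthonormal_eigenbasis A \<mu> u"
    and "\<alpha> > 0" and "\<beta> > 0"
  shows "is_frame_with_bounds UNIV (\<lambda>(i, s). graph_translation u i (graph_modulation u s g)) \<alpha> \<beta>
    \<longleftrightarrow> (\<forall>l. \<alpha> / real CARD('n) \<le> (\<Sum>n\<in>UNIV. (cmod (u l $ n))\<^sup>2 * (cmod (g $ n))\<^sup>2) \<and>
              (\<Sum>n\<in>UNIV. (cmod (u l $ n))\<^sup>2 * (cmod (g $ n))\<^sup>2) \<le> \<beta> / real CARD('n))"
proof -
  have "orthonormal_basis u"
    using assms(3) by (simp add: orthonormal_eigenbasis_def)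
  note expansion = sum_cinner_translation_modulation[OF this]
    and bounds = diagonal_bounds_iff[OF this]
  have "0 < real CARD('n)"
    by simp
  then show ?thesis
    \<comment> \<open>The diagonal entries \<open>c l\<close> are the sums in the claim times
      \<open>N\<close>; dividing by \<open>N\<close> gives the stated bounds.\<close>
    using assms(4,5)
    by (simp add: is_frame_with_bounds_def case_prod_beta' expansion[unfolded case_prod_beta'] bounds
        pos_divide_le_eq pos_le_divide_eq mult.commute)
qed

end
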